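(* Let $f\colon \mathbb{N}\to [0,1]$, and suppose $\mathbf{N} = (N_s)_{s \in \mathbb{N}}$ and $\mathbf{H}=(H_s)_{s\in\mathbb{N}}$ are sequences in $\mathbb{N}$ with $1\prec \mathbf{H}\prec \mathbf{N}$ and $\lim_{s\to\infty} N_s/N_{s+1}=0$. Suppose $(\mathbf{N},\mathbf{H})$ is a $U^2$ good scale for $f$, and let $f = f_{\mathrm{str}} + f_{\mathrm{unf}}$ be a decomposition witnessing this. Then \[ \lim_{s \to \infty} \sup_{g : \mathbb{N} \to [0,1]} \big\|f*_{(\mathbf{N},\mathbf{H})}g-f_{\mathrm{str}}*_{(\mathbf{N},\mathbf{H})}g\big\|_{2,[N_s]}=0. \]
   Context: $N_0=0$, $[M]=\{1,\dots,M\}$; functions on $\mathbb{N}$ are set equal to $0$ at nonpositive integers. Convolution at scale $(\mathbf{N},\mathbf{H})$: $f*_{(\mathbf{N},\mathbf{H})}g(n)=\sum_{t\in\mathbb{N}}1_{(N_{t-1},N_t]}(n)\frac1{H_t}\sum_{m=1}^{H_t}f(n-m)g(m)$. $\|u\|_{2,[N]}=(\frac1N\sum_{n=1}^N|u(n)|^2)^{1/2}$. Sequence order: $1\prec\mathbf{H}$ means $H_s\to\infty$; $\mathbf{H}\prec\mathbf{N}$ means $H_s/N_s\to0$. $e(x)=e^{2\pi ix}$, $\|x\|_{\mathbb{T}}$ = distance to nearest integer, $\mathbb{E}_{n\in\mathbf{N}}a(n)=\lim_s\frac1{N_s}\sum_{n=1}^{N_s}a(n)$, $\|g\|_{2,\mathbf{N}}=(\mathbb{E}_{n\in\mathbf{N}}|g|^2)^{1/2}$.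 Gowers norm: for $u\colon\mathbb{Z}/M\mathbb{Z}\to\mathbb{C}$, $\|u\|^4_{U^2(\mathbb{Z}/M\mathbb{Z})}=M^{-3}\sum_{x,h_1,h_2}u(x)\overline{u(x+h_1)u(x+h_2)}u(x+h_1+h_2)$; $\|g\|_{U^2(\{x+1,\dots,x+L\})}=\|\tilde g\|_{U^2(\mathbb{Z}/M\mathbb{Z})}/\|1_{[L]}\|_{U^2(\mathbb{Z}/M\mathbb{Z})}$ with $M\ge4L$, $\tilde g(n)=1_{[L]}(n)g(x+n)$; $\|g\|_{U^2(\mathbf{N},\mathbf{H})}=\lim_s\frac1{N_s-H_s+1}\sum_{n=1}^{N_s-H_s+1}\|g\|_{U^2(\{n,\dots,n+H_s-1\})}$. $(\mathbf{N},\mathbf{H})$ is a $U^2$ good scale for $f$ if $f=f_{\mathrm{str}}+f_{\mathrm{unf}}$ with: (i) $f_{\mathrm{str}}\in[0,1]$, $\mathbb{E}_{n\in\mathbf{N}}f_{\mathrm{unf}}=0$; (ii) for every $\epsilon>0$ there are $d$, $c_i\colon\mathbb{N}\to\mathbb{C}$ with $\|c_i\|_\infty\le1$ and $\alpha_i\colon\mathbb{N}\to\mathbb{R}$ ($i\le d$) with $\|\sum_ic_i(n)e(n\alpha_i(n))-f_{\mathrm{str}}\|_{2,\mathbf{N}}\le\epsilon$, such that for every $C\ge1$ the sets of $n\in[N_s-H_s+1]$ on which all $\alpha_i(n+\cdot)$ are constant on $[H_s]$, on which all $c_i(n+\cdot)$ are constant on $[H_s]$, and on which every $w\in[-C,C]^d\cap\mathbb{Z}^d$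 has $\|\sum w_i\alpha_i(n)\|_{\mathbb{T}}\le\frac1{CH_s}$ or $\ge\frac{C}{H_s}$, each have size $(1-o(1))(N_s-H_s+1)$; (iii) some $\mathbf{H}'$ with $1\prec\mathbf{H}'\prec\mathbf{H}$ has $\|f_{\mathrm{unf}}\|_{U^2(\mathbf{N},\mathbf{H}')}=0$. *)

theory Defs
  imports "HOL-Analysis.Analysis"
begin

text \<open>
  The positive integers index all sequences and are the domain of all arithmetic functions. Both
  are rendered as functions on \<^typ>\<open>nat\<close>; the value at \<open>0\<close> is never used, except that
  \<open>N 0 = 0\<close> is a convention for the sequence of scales.
\<close>

definition zero_ext :: "(nat \<Rightarrow> real) \<Rightarrow> int \<Rightarrow> real" where
  "zero_ext f k = (if k \<ge> 1 then f (nat k) else 0)"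

definition scale_conv ::
  "(nat \<Rightarrow> nat) \<Rightarrow> (nat \<Rightarrow> nat) \<Rightarrow> (nat \<Rightarrow> real) \<Rightarrow> (nat \<Rightarrow> real) \<Rightarrow> nat \<Rightarrow> real" where
  "scale_conv N H f g n =
     (\<Sum>\<^sub>\<infinity>t\<in>{1..}. indicator {N (t - 1)<..N t} n *
        (1 / real (H t) * (\<Sum>m=1..H t. zero_ext f (int n - int m) * g m)))"

definition l2_norm_upto :: "nat \<Rightarrow> (nat \<Rightarrow> 'a::real_normed_vector) \<Rightarrow> real" where
  "l2_norm_upto K u = sqrt (1 / real K * (\<Sum>n=1..K. (norm (u n))\<^sup>2))"

text \<open>The averages along \<open>N\<close> are limits, so a statement about one of them includes convergence.\<close>

definition has_mean :: "(nat \<Rightarrow> nat) \<Rightarrow> (nat \<Rightarrow> real) \<Rightarrow> real \<Rightarrow> bool" where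
  "has_mean N a l \<longleftrightarrow> (\<lambda>s. 1 / real (N s) * (\<Sum>n=1..N s. a n)) \<longlonglongrightarrow> l"

definition has_l2_norm :: "(nat \<Rightarrow> nat) \<Rightarrow> (nat \<Rightarrow> 'a::real_normed_vector) \<Rightarrow> real \<Rightarrow> bool" where
  "has_l2_norm N u r \<longleftrightarrow> (\<exists>l. has_mean N (\<lambda>n. (norm (u n))\<^sup>2) l \<and> r = sqrt l)"

definition seq_prec :: "(nat \<Rightarrow> nat) \<Rightarrow> (nat \<Rightarrow> nat) \<Rightarrow> bool" where
  "seq_prec H K \<longleftrightarrow> (\<lambda>s. real (H s) / real (K s)) \<longlonglongrightarrow> 0"

definition e_fun :: "real \<Rightarrow> complex" where
  "e_fun x = exp (2 * of_real pi * \<i> * of_real x)"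

definition torus_norm :: "real \<Rightarrow> real" where
  "torus_norm x = \<bar>x - of_int (round x)\<bar>"

text \<open>Functions on the residues modulo \<open>M\<close> are given by their values on \<open>{..<M}\<close>.\<close>

definition gowers_sum :: "nat \<Rightarrow> (nat \<Rightarrow> complex) \<Rightarrow> complex" where
  "gowers_sum M u = (\<Sum>x<M. \<Sum>h1<M. \<Sum>h2<M.
     u x * cnj (u ((x + h1) mod M) * u ((x + h2) mod M)) * u ((x + h1 + h2) mod M))"

definition gowers_norm :: "nat \<Rightarrow> (nat \<Rightarrow> complex) \<Rightarrow> real" where
  "gowers_norm M u = root 4 (Re (gowers_sum M u / of_nat M ^ 3))"

definition int_cut :: "nat \<Rightarrow> nat \<Rightarrow> (nat \<Rightarrow> complex) \<Rightarrow> nat \<Rightarrow> complex" where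
  "int_cut x L g n = indicator {1..L} n * g (x + n)"

definition gowers_norm_int_mod :: "nat \<Rightarrow> nat \<Rightarrow> nat \<Rightarrow> (nat \<Rightarrow> complex) \<Rightarrow> real" where
  "gowers_norm_int_mod M x L g = gowers_norm M (int_cut x L g) / gowers_norm M (indicator {1..L})"

text \<open>
  The norm on \<open>{x + 1, \<dots>, x + L}\<close>. The modulus may be any \<open>M \<ge> 4 * L\<close>, see
  \<open>gowers_norm_int_eq\<close> below.
\<close>

definition gowers_norm_int :: "nat \<Rightarrow> nat \<Rightarrow> (nat \<Rightarrow> complex) \<Rightarrow> real" where
  "gowers_norm_int x L g = gowers_norm_int_mod (4 * L) x L g"

text \<open>The interval \<open>{n, \<dots>, n + H s - 1}\<close> starts after \<open>x = n - 1\<close>.\<close>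

definition has_gowers_norm ::
  "(nat \<Rightarrow> nat) \<Rightarrow> (nat \<Rightarrow> nat) \<Rightarrow> (nat \<Rightarrow> complex) \<Rightarrow> real \<Rightarrow> bool" where
  "has_gowers_norm N H g r \<longleftrightarrow>
     (\<lambda>s. 1 / real (N s + 1 - H s) * (\<Sum>n=1..N s + 1 - H s. gowers_norm_int (n - 1) (H s) g))
       \<longlonglongrightarrow> r"

definition almost_all_starts ::
  "(nat \<Rightarrow> nat) \<Rightarrow> (nat \<Rightarrow> nat) \<Rightarrow> (nat \<Rightarrow> nat \<Rightarrow> bool) \<Rightarrow> bool" where
  "almost_all_starts N H P \<longleftrightarrow>
     (\<lambda>s. real (card {n \<in> {1..N s + 1 - H s}. P s n}) / real (N s + 1 - H s)) \<longlonglongrightarrow> 1"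

definition U2_good_decomposition ::
  "(nat \<Rightarrow> nat) \<Rightarrow> (nat \<Rightarrow> nat) \<Rightarrow> (nat \<Rightarrow> real) \<Rightarrow> (nat \<Rightarrow> real) \<Rightarrow> (nat \<Rightarrow> real) \<Rightarrow> bool" where
  "U2_good_decomposition N H f f_str f_unf \<longleftrightarrow>
     (\<forall>n\<ge>1. f n = f_str n + f_unf n) \<and>
     (\<forall>n\<ge>1. f_str n \<in> {0..1}) \<and> has_mean N f_unf 0 \<and>
     (\<forall>\<epsilon>>0. \<exists>(d::nat) (c :: nat \<Rightarrow> nat \<Rightarrow> complex) (\<alpha> :: nat \<Rightarrow> nat \<Rightarrow> real).
        (\<forall>i\<in>{1..d}. \<forall>n\<ge>1. norm (c i n) \<le> 1) \<and>
        (\<exists>r\<le>\<epsilon>. has_l2_norm N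
           (\<lambda>n. (\<Sum>i=1..d. c i n * e_fun (real n * \<alpha> i n)) - of_real (f_str n)) r) \<and>
        (\<forall>C::real. C \<ge> 1 \<longrightarrow>
           almost_all_starts N H (\<lambda>s n. \<forall>i\<in>{1..d}. (\<lambda>h. \<alpha> i (n + h)) constant_on {1..H s}) \<and>
           almost_all_starts N H (\<lambda>s n. \<forall>i\<in>{1..d}. (\<lambda>h. c i (n + h)) constant_on {1..H s}) \<and>
           almost_all_starts N H (\<lambda>s n. \<forall>w :: nat \<Rightarrow> int.
             (\<forall>i\<in>{1..d}. real_of_int (w i) \<in> {- C..C}) \<longrightarrow>
             torus_norm (\<Sum>i=1..d. of_int (w i) * \<alpha> i n) \<le> 1 / (C * real (H s)) \<or>
             torus_norm (\<Sum>i=1..d. of_int (w i) * \<alpha> i n) \<ge> C / real (H s)))) \<and>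
     (\<exists>H' :: nat \<Rightarrow> nat. (\<forall>s\<ge>1. H' s \<ge> 1) \<and> filterlim H' at_top sequentially \<and> seq_prec H' H \<and>
        has_gowers_norm N H' (\<lambda>n. of_real (f_unf n)) 0)"

definition U2_good_scale :: "(nat \<Rightarrow> nat) \<Rightarrow> (nat \<Rightarrow> nat) \<Rightarrow> (nat \<Rightarrow> real) \<Rightarrow> bool" where
  "U2_good_scale N H f \<longleftrightarrow> (\<exists>f_str f_unf. U2_good_decomposition N H f f_str f_unf)"


lemma sum_shift_mod:
  fixes F :: "nat \<Rightarrow> 'a::comm_monoid_add"
  shows "(\<Sum>h<M. F ((x + h) mod M)) = (\<Sum>y<M. F y)"
proof -
  have inj: "inj_on (\<lambda>h. (x + h) mod M) {..<M}"
  proof (rule inj_onI)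
    have inv: "((x + h) mod M + (M - x mod M)) mod M = h" if "h < M" for h
    proof -
      have "x mod M + h + (M - x mod M) = h + M"
        using that mod_less_divisor[of M x] by simp
      then have "(x mod M + h + (M - x mod M)) mod M = h" using that by simp
      then show ?thesis by (metis mod_add_left_eq)
    qed
    fix h k assume "h \<in> {..<M}" "k \<in> {..<M}" "(x + h) mod M = (x + k) mod M"
    then show "h = k" using inv[of h] inv[of k] by simp
  qed
  have "(\<lambda>h. (x + h) mod M) ` {..<M} \<subseteq> {..<M}" by auto
  then have "(\<lambda>h. (x + h) mod M) ` {..<M} = {..<M}"
    using inj by (intro endo_inj_surj) auto
  then show ?thesis
    using sum.reindex[OF inj, of F] by (simp add: o_def)
qed

lemma gowers_sum_eq_squares:
  "gowers_sum M u = of_real (\<Sum>h<M. (norm (\<Sum>x<M. u x * cnj (u ((x + h) mod M))))\<^sup>2)"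
proof -
  have "gowers_sum M u = (\<Sum>h<M. \<Sum>x<M. u x * cnj (u ((x + h) mod M)) *
          (\<Sum>k<M. cnj (u ((x + k) mod M)) * u (((x + k) mod M + h) mod M)))"
    unfolding gowers_sum_def
    by (subst sum.swap) (simp add: sum_distrib_left algebra_simps mod_simps)
  also have "\<dots> = (\<Sum>h<M. \<Sum>x<M. u x * cnj (u ((x + h) mod M)) *
          (\<Sum>y<M. cnj (u y) * u ((y + h) mod M)))"
    by (subst sum_shift_mod) simp
  also have "\<dots> = (\<Sum>h<M. (\<Sum>x<M. u x * cnj (u ((x + h) mod M))) *
          cnj (\<Sum>x<M. u x * cnj (u ((x + h) mod M))))"
    by (simp add: sum_distrib_right)
  finally show ?thesis
    by (simp only: complex_norm_square of_real_sum)
qed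

lemma gowers_norm_power4: "complex_of_real (gowers_norm M u ^ 4) = gowers_sum M u / of_nat M ^ 3"
proof -
  define S where "S = (\<Sum>h<M. (norm (\<Sum>x<M. u x * cnj (u ((x + h) mod M))))\<^sup>2)"
  have "S \<ge> 0" by (simp add: S_def sum_nonneg)
  moreover have *: "gowers_sum M u / of_nat M ^ 3 = complex_of_real (S / real M ^ 3)"
    by (simp add: gowers_sum_eq_squares S_def)
  ultimately show ?thesis
    unfolding gowers_norm_def * by simp
qed

lemma gowers_sum_cut:
  assumes "M \<ge> 3 * L"
  shows "gowers_sum M (int_cut x L g) =
    (\<Sum>a=1..L. \<Sum>b=1..L. \<Sum>c=1..L. g (x + a) * cnj (g (x + b) * g (x + c)) *
       (if a < b + c then int_cut x L g (b + c - a) else 0))"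
proof -
  let ?v = "int_cut x L g"
  have "gowers_sum M ?v = (\<Sum>a<M. \<Sum>k<M. \<Sum>h<M.
      ?v a * cnj (?v ((a + h) mod M) * ?v ((a + k) mod M)) * ?v (((a + h) mod M + (a + k) mod M + (M - a)) mod M))"
    unfolding gowers_sum_def
  proof (rule sum.cong[OF refl], subst sum.swap, intro sum.cong refl)
    fix a k h assume "a \<in> {..<M}" 
    then have "a + h + (a + k) + (M - a) = a + h + k + M" by simp
    then have "((a + h) mod M + (a + k) mod M + (M - a)) mod M = (a + h + k) mod M"
      by (metis mod_add_eq mod_add_left_eq mod_add_self2)
    then show "?v a * cnj (?v ((a + h) mod M) * ?v ((a + k) mod M)) * ?v ((a + h + k) mod M) =
      ?v a * cnj (?v ((a + h) mod M) * ?v ((a + k) mod M)) *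
        ?v (((a + h) mod M + (a + k) mod M + (M - a)) mod M)" by simp
  qed
  also have "\<dots> = (\<Sum>a<M. \<Sum>k<M. \<Sum>b<M.
      ?v a * cnj (?v b * ?v ((a + k) mod M)) * ?v ((b + (a + k) mod M + (M - a)) mod M))"
    by (intro sum.cong refl sum_shift_mod)
  also have "\<dots> = (\<Sum>a<M. \<Sum>c<M. \<Sum>b<M.
      ?v a * cnj (?v b * ?v c) * ?v ((b + c + (M - a)) mod M))"
    by (intro sum.cong refl
      sum_shift_mod[of "\<lambda>c. \<Sum>b<M. ?v a * cnj (?v b * ?v c) * ?v ((b + c + (M - a)) mod M)" for a])
  also have "\<dots> = (\<Sum>a<M. \<Sum>b<M. \<Sum>c<M.
      ?v a * cnj (?v b * ?v c) * ?v ((b + c + (M - a)) mod M))"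
    by (rule sum.cong[OF refl], rule sum.swap)
  also have "\<dots> = (\<Sum>a=1..L. \<Sum>b=1..L. \<Sum>c=1..L. g (x + a) * cnj (g (x + b) * g (x + c)) *
       (if a < b + c then ?v (b + c - a) else 0))"
  proof -
    have restr: "(\<Sum>a<M. F a) = (\<Sum>a=1..L. G a)"
      if "\<And>a. a < M \<Longrightarrow> a \<notin> {1..L} \<Longrightarrow> F a = 0" "\<And>a. a \<in> {1..L} \<Longrightarrow> F a = G a"
      for F G :: "nat \<Rightarrow> complex"
    proof -
      have "{1..L} \<subseteq> {..<M}" using assms by auto
      then have "(\<Sum>a=1..L. F a) = (\<Sum>a<M. F a)"
        using that(1) by (intro sum.mono_neutral_left) auto
      then show ?thesis using that(2) by simp
    qed
    have zero: "?v a = 0" if "a \<notin> {1..L}" for a using that by (simp add: int_cut_def)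
    have last: "?v ((b + c + (M - a)) mod M) = (if a < b + c then ?v (b + c - a) else 0)"
      if "a \<in> {1..L}" "b \<in> {1..L}" "c \<in> {1..L}" for a b c
    proof (cases "a < b + c")
      case True
      then have "b + c + (M - a) = (b + c - a) + M" "b + c - a < M"
        using that assms by auto
      then show ?thesis using True by (metis mod_add_self2 mod_less)
    next
      case False
      then consider "b + c = a" | "b + c < a" by linarith
      then show ?thesis
      proof cases
        case 1
        then have "b + c + (M - a) = M" using that assms by auto
        then show ?thesis using False by (simp add: zero)
      next
        case 2
        then have "b + c + (M - a) < M" "b + c + (M - a) > L" using that assms by auto
        then show ?thesis using False by (simp add: zero)
      qed
    qed
    show ?thesis
      by (intro restr) (simp_all only: last zero, simp_all add: int_cut_def)
  qed
  finally show ?thesis .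
qed

lemma gowers_norm_int_mod_indep:
  assumes "M \<ge> 3 * L" "M' \<ge> 3 * L" "L \<ge> 1"
  shows "gowers_norm_int_mod M x L g = gowers_norm_int_mod M' x L g"
proof -
  have ind: "indicator {1..L} = int_cut x L (\<lambda>_. 1)" by (simp add: int_cut_def fun_eq_iff)
  have red: "gowers_norm_int_mod K x L g =
      root 4 (Re (gowers_sum K (int_cut x L g)) / Re (gowers_sum K (int_cut x L (\<lambda>_. 1))))"
    if "K \<ge> 1" for K
  proof -
    have "Re (z / of_nat K ^ 3) = Re z / real K ^ 3" for z
      by (metis Re_divide_of_real of_real_of_nat_eq of_real_power)
    then show ?thesis using that
      unfolding gowers_norm_int_mod_def gowers_norm_def ind
      by (simp flip: real_root_divide)
  qed
  show ?thesis
    using assms by (simp add: red gowers_sum_cut)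
qed

lemma gowers_norm_int_eq:
  assumes "L \<ge> 1" "M \<ge> 4 * L"
  shows "gowers_norm_int x L g = gowers_norm_int_mod M x L g"
  unfolding gowers_norm_int_def using assms by (intro gowers_norm_int_mod_indep) auto

end

theory Submission
  imports Defs
begin

text \<open>
  The function \<open>u = f_unf\<close> is bounded by \<open>1\<close> and has vanishing \<open>U\<^sup>2\<close> norm at some scale \<open>L\<close> much smaller than \<open>H\<close>. On the block \<open>(N (s - 1), N s]\<close>
  let \<open>a n\<close> be the convolution of \<open>u\<close> with \<open>g\<close>. Then \<open>\<Sum>n. a n ^ 2\<close> is, up to the factor
  \<open>1 / H s\<close>, the bilinear form \<open>\<Sum>m k. g m * u k * a (k + m)\<close>. Cutting both variables into windows
  of length \<open>L\<close> and applying the Cauchy-Schwarz inequality twice in each window eliminates \<open>g\<close> and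
  \<open>a\<close> and leaves the local \<open>U\<^sup>2\<close> norm of \<open>u\<close>, so the bound is uniform in \<open>g\<close>. The earlier blocks
  are negligible because \<open>N (s - 1) / N s\<close> tends to \<open>0\<close>.
\<close>

section \<open>The U^2 norm on a cyclic group and bilinear sums\<close>

lemma gowers_sum_of_real:
  "gowers_sum M (\<lambda>n. of_real (v n)) = of_real (\<Sum>h<M. (\<Sum>x<M. v x * v ((x + h) mod M))\<^sup>2)"
proof -
  have "(norm (\<Sum>x<M. complex_of_real (v x) * cnj (of_real (v ((x + h) mod M)))))\<^sup>2
      = (\<Sum>x<M. v x * v ((x + h) mod M))\<^sup>2" for h
  proof -
    have "(\<Sum>x<M. complex_of_real (v x) * cnj (of_real (v ((x + h) mod M))))
        = of_real (\<Sum>x<M. v x * v ((x + h) mod M))" by simp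
    then show ?thesis by (simp only: norm_of_real power2_abs)
  qed
  then show ?thesis unfolding gowers_sum_eq_squares by simp
qed

text \<open>\<open>root 4\<close> is negative on negative reals, so the sign needs an argument:
  \<open>gowers_norm_power4\<close> exhibits the radicand as a fourth power.\<close>

lemma gowers_norm_nonneg: "gowers_norm M u \<ge> 0"
proof -
  have "Re (gowers_sum M u / of_nat M ^ 3) = gowers_norm M u ^ 4"
    by (metis gowers_norm_power4 Re_complex_of_real)
  then have "Re (gowers_sum M u / of_nat M ^ 3) \<ge> 0" by simp
  then show ?thesis by (simp add: gowers_norm_def)
qed

lemma gowers_norm_of_real_power4:
  assumes "M \<ge> 1"
  shows "gowers_norm M (\<lambda>n. of_real (v n)) ^ 4 * real M ^ 3
           = (\<Sum>h<M. (\<Sum>x<M. v x * v ((x + h) mod M))\<^sup>2)"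
proof -
  have "complex_of_real (gowers_norm M (\<lambda>n. of_real (v n)) ^ 4 * real M ^ 3)
     = of_real (\<Sum>h<M. (\<Sum>x<M. v x * v ((x + h) mod M))\<^sup>2)"
    using assms gowers_norm_power4[of M "\<lambda>n. of_real (v n)"]
    unfolding gowers_sum_of_real by (simp add: field_simps)
  then show ?thesis by (simp only: of_real_eq_iff)
qed

lemma sum_square_le_card:
  fixes a :: "nat \<Rightarrow> real"
  assumes "\<And>x. x < M \<Longrightarrow> \<bar>a x\<bar> \<le> B"
  shows "(\<Sum>x<M. (a x)\<^sup>2) \<le> real M * B\<^sup>2"
proof -
  have "(a x)\<^sup>2 \<le> B\<^sup>2" if "x \<in> {..<M}" for x
    using assms[of x] that by (metis lessThan_iff abs_ge_zero power2_abs power_mono)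
  then show ?thesis using sum_bounded_above[of "{..<M}" "\<lambda>x. (a x)\<^sup>2" "B\<^sup>2"] by simp
qed

lemma abs_correlation_le:
  fixes v w :: "nat \<Rightarrow> real"
  assumes "\<And>x. \<bar>v x\<bar> \<le> 1" "\<And>x. \<bar>w x\<bar> \<le> 1"
  shows "\<bar>\<Sum>x<M. v x * w ((x + h) mod M)\<bar> \<le> real M"
proof -
  have "\<bar>v x * w ((x + h) mod M)\<bar> \<le> 1" for x
    using assms by (simp add: abs_mult mult_le_one)
  then have "(\<Sum>x<M. \<bar>v x * w ((x + h) mod M)\<bar>) \<le> (\<Sum>x<M. 1)" by (intro sum_mono) auto
  then show ?thesis
    using order_trans[OF sum_abs[of "\<lambda>x. v x * w ((x + h) mod M)" "{..<M}"]] by simp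
qed

lemma gowers_norm_of_real_le_1:
  fixes v :: "nat \<Rightarrow> real"
  assumes "M \<ge> 1" "\<And>x. \<bar>v x\<bar> \<le> 1"
  shows "gowers_norm M (\<lambda>n. of_real (v n)) \<le> 1"
proof -
  have "gowers_norm M (\<lambda>n. of_real (v n)) ^ 4 * real M ^ 3 \<le> real M * (real M)\<^sup>2"
    unfolding gowers_norm_of_real_power4[OF assms(1)]
    by (intro sum_square_le_card abs_correlation_le assms)
  also have "\<dots> = 1 * real M ^ 3" by (simp add: eval_nat_numeral)
  finally have "gowers_norm M (\<lambda>n. of_real (v n)) ^ 4 \<le> 1 ^ 4"
    using assms(1) by simp
  \<comment> \<open>The rule compares powers with exponent \<open>Suc n\<close>, so
    \<open>n = 3\<close> gives fourth powers.\<close>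
  then show ?thesis by (rule power_le_imp_le_base[where n = 3, simplified]) simp
qed

text \<open>Expanding the square with second index j + k gives the products
  \<open>v j * v (j + k)\<close> and \<open>w (j + h) * w (j + h + k)\<close> modulo
  \<open>M\<close>. For fixed \<open>j\<close> the point j + h runs through all residues, so summing
  over \<open>h\<close> decouples \<open>w\<close> from \<open>v\<close>.\<close>

lemma sum_correlation_squares:
  fixes v w :: "nat \<Rightarrow> real"
  shows "(\<Sum>h<M. (\<Sum>j<M. v j * w ((j + h) mod M))\<^sup>2)
       = (\<Sum>k<M. (\<Sum>j<M. v j * v ((j + k) mod M)) * (\<Sum>j<M. w j * w ((j + k) mod M)))"
proof -
  have "(\<Sum>h<M. (\<Sum>j<M. v j * w ((j + h) mod M))\<^sup>2)
     = (\<Sum>h<M. \<Sum>j<M. v j * w ((j + h) mod M) * (\<Sum>i<M. v i * w ((i + h) mod M)))"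
    by (simp add: power2_eq_square sum_distrib_right)
  also have "\<dots> = (\<Sum>h<M. \<Sum>j<M. v j * w ((j + h) mod M) *
       (\<Sum>k<M. v ((j + k) mod M) * w (((j + k) mod M + h) mod M)))"
    by (subst sum_shift_mod[of "\<lambda>i. v i * w ((i + h) mod M)" for h]) simp
  also have "\<dots> = (\<Sum>h<M. \<Sum>j<M. \<Sum>k<M. v j * v ((j + k) mod M) *
       (w ((j + h) mod M) * w (((j + h) mod M + k) mod M)))"
    by (simp add: sum_distrib_left mod_simps algebra_simps)
  also have "\<dots> = (\<Sum>j<M. \<Sum>h<M. \<Sum>k<M. v j * v ((j + k) mod M) *
       (w ((j + h) mod M) * w (((j + h) mod M + k) mod M)))"
    by (rule sum.swap)
  also have "\<dots> = (\<Sum>j<M. \<Sum>k<M. \<Sum>h<M. v j * v ((j + k) mod M) *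
       (w ((j + h) mod M) * w (((j + h) mod M + k) mod M)))"
    by (intro sum.cong refl sum.swap)
  also have "\<dots> = (\<Sum>j<M. \<Sum>k<M. v j * v ((j + k) mod M) * (\<Sum>y<M. w y * w ((y + k) mod M)))"
    by (simp only: sum_distrib_left[symmetric]
      sum_shift_mod[of "\<lambda>y. w y * w ((y + k) mod M)" for k])
  also have "\<dots> = (\<Sum>k<M. \<Sum>j<M. v j * v ((j + k) mod M) * (\<Sum>y<M. w y * w ((y + k) mod M)))"
    by (rule sum.swap)
  finally show ?thesis by (simp add: sum_distrib_right)
qed

text \<open>Cauchy-Schwarz over \<open>h\<close> removes \<open>\<theta>\<close>. What remains is an
  inner product of the autocorrelations of \<open>v\<close> and \<open>w\<close>, and a second
  Cauchy-Schwarz separates them: the part in \<open>w\<close> is at most M^3, the part in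
  \<open>v\<close> is M^3 times the fourth power of its norm.\<close>

lemma bilinear_sum_le_gowers_norm:
  fixes v w \<theta> :: "nat \<Rightarrow> real"
  assumes "M \<ge> 1" "\<And>x. \<bar>w x\<bar> \<le> 1" "\<And>h. \<bar>\<theta> h\<bar> \<le> 1"
  shows "\<bar>\<Sum>h<M. \<theta> h * (\<Sum>j<M. v j * w ((j + h) mod M))\<bar>
           \<le> (real M)\<^sup>2 * gowers_norm M (\<lambda>n. of_real (v n))"
proof -
  define S where "S h = (\<Sum>j<M. v j * w ((j + h) mod M))" for h
  define V where "V k = (\<Sum>j<M. v j * v ((j + k) mod M))" for k
  define W where "W k = (\<Sum>j<M. w j * w ((j + k) mod M))" for k
  let ?G = "gowers_norm M (\<lambda>n. of_real (v n))"
  have "(\<Sum>h<M. \<theta> h * S h)\<^sup>2 \<le> (\<Sum>h<M. (\<theta> h)\<^sup>2) * (\<Sum>h<M. (S h)\<^sup>2)"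
    by (rule Cauchy_Schwarz_ineq_sum)
  also have "\<dots> \<le> real M * (\<Sum>h<M. (S h)\<^sup>2)"
    using sum_square_le_card[of M \<theta> 1] assms(3) by (intro mult_right_mono) (auto intro: sum_nonneg)
  finally have 1: "(\<Sum>h<M. \<theta> h * S h)\<^sup>2 \<le> real M * (\<Sum>h<M. (S h)\<^sup>2)" .
  have "(\<Sum>h<M. (S h)\<^sup>2)\<^sup>2 = (\<Sum>k<M. V k * W k)\<^sup>2"
    unfolding S_def V_def W_def sum_correlation_squares ..
  also have "\<dots> \<le> (\<Sum>k<M. (V k)\<^sup>2) * (\<Sum>k<M. (W k)\<^sup>2)"
    by (rule Cauchy_Schwarz_ineq_sum)
  also have "\<dots> \<le> (\<Sum>k<M. (V k)\<^sup>2) * (real M * (real M)\<^sup>2)"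
    unfolding W_def
    by (intro mult_left_mono sum_square_le_card abs_correlation_le assms sum_nonneg) auto
  also have "\<dots> = ?G ^ 4 * real M ^ 3 * (real M * (real M)\<^sup>2)"
    unfolding V_def gowers_norm_of_real_power4[OF assms(1)] ..
  finally have 2: "(\<Sum>h<M. (S h)\<^sup>2)\<^sup>2 \<le> ?G ^ 4 * real M ^ 3 * (real M * (real M)\<^sup>2)" .
  have "\<bar>\<Sum>h<M. \<theta> h * S h\<bar> ^ 4 = ((\<Sum>h<M. \<theta> h * S h)\<^sup>2)\<^sup>2" by (simp flip: power_mult)
  also have "\<dots> \<le> (real M * (\<Sum>h<M. (S h)\<^sup>2))\<^sup>2" by (rule power_mono[OF 1]) simp
  also have "\<dots> \<le> (real M)\<^sup>2 * (?G ^ 4 * real M ^ 3 * (real M * (real M)\<^sup>2))"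
    unfolding power_mult_distrib by (rule mult_left_mono[OF 2]) simp
  also have "\<dots> = ((real M)\<^sup>2 * ?G) ^ 4" by (simp add: eval_nat_numeral mult_ac)
  finally show ?thesis
    unfolding S_def by (rule power_le_imp_le_base[where n = 3, simplified])
      (simp add: gowers_norm_nonneg)
qed

section \<open>The U^2 norm on an interval\<close>

lemma gowers_norm_int_nonneg: "gowers_norm_int x L g \<ge> 0"
  unfolding gowers_norm_int_def gowers_norm_int_mod_def by (simp add: gowers_norm_nonneg)

text \<open>The normalising norm of the indicator lies in (0, 1], so dividing by it cannot decrease
  the value.\<close>

lemma gowers_norm_cut_le_gowers_norm_int:
  assumes "L \<ge> 1"
  shows "gowers_norm (4 * L) (int_cut x L g) \<le> gowers_norm_int x L g"
proof -
  let ?M = "4 * L" and ?i = "indicator {1..L} :: nat \<Rightarrow> real"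
  let ?I = "gowers_norm ?M (indicator {1..L})"
  have ind: "(indicator {1..L} :: nat \<Rightarrow> complex) = (\<lambda>n. of_real (?i n))"
    by (auto simp: fun_eq_iff indicator_def)
  have "?I \<le> 1" unfolding ind using assms
    by (intro gowers_norm_of_real_le_1) (auto simp: indicator_def)
  \<comment> \<open>If the norm vanished, so would every term of the autocorrelation at shift 0, but
    the term at x = 1 equals 1.\<close>
  moreover have "?I \<noteq> 0"
  proof
    assume "?I = 0"
    then have "(\<Sum>h<?M. (\<Sum>x<?M. ?i x * ?i ((x + h) mod ?M))\<^sup>2) = 0"
      using gowers_norm_of_real_power4[of ?M ?i] assms unfolding ind by simp
    then have "\<forall>h\<in>{..<?M}. (\<Sum>x<?M. ?i x * ?i ((x + h) mod ?M))\<^sup>2 = 0"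
      by (subst (asm) sum_nonneg_eq_0_iff) auto
    then have "(\<Sum>x<?M. ?i x * ?i ((x + 0) mod ?M))\<^sup>2 = 0"
      by (rule bspec) (use assms in simp)
    then have "(\<Sum>x<?M. ?i x * ?i ((x + 0) mod ?M)) = 0" by (simp only: power_eq_0_iff)
    then have "\<forall>x\<in>{..<?M}. ?i x * ?i ((x + 0) mod ?M) = 0"
      by (subst (asm) sum_nonneg_eq_0_iff) auto
    then have "?i 1 * ?i ((1 + 0) mod ?M) = 0"
      by (rule bspec) (use assms in simp)
    then show False using assms by (simp add: indicator_def)
  qed
  ultimately have "0 < ?I" "?I \<le> 1" using gowers_norm_nonneg[of ?M "indicator {1..L}"] by auto
  then have "gowers_norm ?M (int_cut x L g) * ?I \<le> gowers_norm ?M (int_cut x L g) * 1"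
    by (intro mult_left_mono gowers_norm_nonneg)
  then show ?thesis
    using \<open>0 < ?I\<close> unfolding gowers_norm_int_def gowers_norm_int_mod_def
    by (simp add: pos_le_divide_eq)
qed

text \<open>Since j + h \<le> 2 * L < 4 * L, nothing wraps around modulo 4 * L, and after extension
  by zero the cyclic bound applies. The 16 comes from the square of this modulus.\<close>

lemma bilinear_sum_le_gowers_norm_int:
  fixes u w \<theta> :: "nat \<Rightarrow> real"
  assumes "L \<ge> 1" "\<And>x. \<bar>w x\<bar> \<le> 1" "\<And>h. \<bar>\<theta> h\<bar> \<le> 1"
  shows "\<bar>\<Sum>h=1..L. \<Sum>j=1..L. \<theta> h * u (x + j) * w (j + h)\<bar>
           \<le> (real L)\<^sup>2 * (16 * gowers_norm_int x L (\<lambda>n. of_real (u n)))"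
proof -
  let ?M = "4 * L"
  define \<theta>' where "\<theta>' h = (if h \<in> {1..L} then \<theta> h else 0)" for h
  define v where "v j = indicator {1..L} j * u (x + j)" for j
  have cut: "int_cut x L (\<lambda>n. of_real (u n)) = (\<lambda>n. of_real (v n))"
    by (auto simp: fun_eq_iff int_cut_def v_def indicator_def)
  have sub: "{1..L} \<subseteq> {..<?M}" using assms(1) by auto
  have "(\<Sum>h=1..L. \<Sum>j=1..L. \<theta> h * u (x + j) * w (j + h))
     = (\<Sum>h=1..L. \<theta>' h * (\<Sum>j=1..L. v j * w ((j + h) mod ?M)))"
    by (intro sum.cong refl) (auto simp: sum_distrib_left \<theta>'_def v_def intro!: sum.cong)
  also have "\<dots> = (\<Sum>h=1..L. \<theta>' h * (\<Sum>j<?M. v j * w ((j + h) mod ?M)))"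
    by (intro sum.cong refl arg_cong2[where f = "(*)"] sum.mono_neutral_left sub)
      (auto simp: v_def)
  also have "\<dots> = (\<Sum>h<?M. \<theta>' h * (\<Sum>j<?M. v j * w ((j + h) mod ?M)))"
    by (intro sum.mono_neutral_left sub) (auto simp: \<theta>'_def)
  finally have "\<bar>\<Sum>h=1..L. \<Sum>j=1..L. \<theta> h * u (x + j) * w (j + h)\<bar>
      \<le> (real ?M)\<^sup>2 * gowers_norm ?M (\<lambda>n. of_real (v n))"
    using bilinear_sum_le_gowers_norm[of ?M w \<theta>' v] assms by (simp add: \<theta>'_def)
  also have "\<dots> \<le> (real ?M)\<^sup>2 * gowers_norm_int x L (\<lambda>n. of_real (u n))"
    using gowers_norm_cut_le_gowers_norm_int[OF assms(1), of x "\<lambda>n. of_real (u n)"]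
    unfolding cut by (intro mult_left_mono) auto
  finally show ?thesis by (simp add: power_mult_distrib)
qed

section \<open>From local windows to the global bilinear form\<close>

lemma sum_over_windows:
  fixes F :: "int \<Rightarrow> real"
  assumes "\<And>k. k \<notin> {1..K} \<Longrightarrow> F k = 0"
  shows "(\<Sum>p\<in>{- int L..K}. \<Sum>j=1..L. F (p + int j)) = real L * (\<Sum>k\<in>{1..K}. F k)"
proof -
  \<comment> \<open>The range of \<open>p\<close> is wide enough that translation by any
    \<open>j\<close> up to \<open>L\<close> covers \<open>{1..K}\<close>; it overshoots only where
    \<open>F\<close> vanishes.\<close>
  have "(\<Sum>p\<in>{- int L..K}. F (p + int j)) = (\<Sum>k\<in>{1..K}. F k)" if "j \<in> {1..L}" for j
  proof (rule sum.reindex_bij_witness_not_neutral[where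
        S' = "{- int L..K} - {1 - int j..K - int j}" and T' = "{}"
        and i = "\<lambda>k. k - int j" and j = "\<lambda>p. p + int j"])
  qed (use that assms in auto)
  then have "(\<Sum>j=1..L. \<Sum>p\<in>{- int L..K}. F (p + int j)) = (\<Sum>j=1..L. \<Sum>k\<in>{1..K}. F k)"
    by (rule sum.cong[OF refl])
  then show ?thesis by (subst sum.swap) simp
qed

text \<open>
  Averaging both variables over windows of length \<open>L\<close> turns the global bilinear form into
  an average of local ones; only the windows that stick out of \<open>{1..N}\<close> are bounded trivially.
\<close>

lemma global_bilinear_sum_le:
  fixes u :: "nat \<Rightarrow> real" and g a :: "int \<Rightarrow> real" and L H N :: nat
  assumes L: "1 \<le> L" "L \<le> H" "H \<le> N"
    and u: "\<And>n. n \<ge> 1 \<Longrightarrow> \<bar>u n\<bar> \<le> 1"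
    and g: "\<And>m. \<bar>g m\<bar> \<le> 1" "\<And>m. m \<notin> {1..int H} \<Longrightarrow> g m = 0"
    and a: "\<And>n. \<bar>a n\<bar> \<le> 1" "\<And>n. n \<notin> {1..int N} \<Longrightarrow> a n = 0"
  shows "\<bar>\<Sum>m\<in>{1..int H}. \<Sum>k\<in>{1..int N}. g m * zero_ext u k * a (k + m)\<bar>
    \<le> 3 * real H * (16 * (\<Sum>n=1..N + 1 - L. gowers_norm_int (n - 1) L (\<lambda>n. of_real (u n))) + 2 * real L)"
proof -
  define G where "G x = gowers_norm_int x L (\<lambda>n. of_real (u n))" for x
  define F where "F m k = g m * zero_ext u k * a (k + m)" for m k
  \<comment> \<open>The window after \<open>q\<close> lies inside \<open>{1..N}\<close> exactly for
    0 \<le> q \<le> N - L; the other windows get the trivial bound.\<close>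
  define B where "B q = (if q \<in> {0..int N - int L} then 16 * G (nat q) else 1)" for q
  define X where "X = (\<Sum>m\<in>{1..int H}. \<Sum>k\<in>{1..int N}. F m k)"
  have U: "\<bar>zero_ext u k\<bar> \<le> 1" for k using u by (simp add: zero_ext_def)
  have F1: "F m k = 0" if "m \<notin> {1..int H}" for m k using g(2)[OF that] by (simp add: F_def)
  \<comment> \<open>Below 1 the factor \<open>zero_ext u k\<close> vanishes; above \<open>N\<close>
    a positive \<open>m\<close> pushes k + m beyond the support of \<open>a\<close>.\<close>
  have F2: "F m k = 0" if "k \<notin> {1..int N}" for m k
  proof (cases "m \<in> {1..int H} \<and> k \<ge> 1")
    case True
    then have "k + m \<notin> {1..int N}" using that by auto
    then show ?thesis using a(2) by (simp add: F_def)
  next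
    case False
    then consider "m \<notin> {1..int H}" | "k < 1" by linarith
    then show ?thesis by cases (use F1 in \<open>auto simp: F_def zero_ext_def\<close>)
  qed
  have F_le: "\<bar>F m k\<bar> \<le> 1" for m k
    using g(1) U a(1) by (simp add: F_def abs_mult mult_le_one)
  \<comment> \<open>The start \<open>p\<close> only translates \<open>g\<close> and
    \<open>a\<close>, which serve as arbitrary bounded weights in the local estimate, so the bound
    depends on \<open>q\<close> alone.\<close>
  have window: "\<bar>\<Sum>h=1..L. \<Sum>j=1..L. F (p + int h) (q + int j)\<bar> \<le> (real L)\<^sup>2 * B q" for p q
  proof (cases "q \<in> {0..int N - int L}")
    case True
    define x where "x = nat q"
    have x: "q = int x" using True by (simp add: x_def)
    have "(\<Sum>h=1..L. \<Sum>j=1..L. F (p + int h) (q + int j))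
       = (\<Sum>h=1..L. \<Sum>j=1..L. g (p + int h) * u (x + j) * a (q + p + int (j + h)))"
      by (intro sum.cong refl) (auto simp: F_def zero_ext_def x algebra_simps nat_add_distrib)
    also have "\<bar>\<dots>\<bar> \<le> (real L)\<^sup>2 * (16 * G x)"
      unfolding G_def by (rule bilinear_sum_le_gowers_norm_int) (use L g a in auto)
    finally show ?thesis using True by (simp add: B_def x_def)
  next
    case False
    have "\<bar>\<Sum>h=1..L. \<Sum>j=1..L. F (p + int h) (q + int j)\<bar> \<le> (\<Sum>h=1..L. \<Sum>j=1..L. 1)"
      by (intro order_trans[OF sum_abs] sum_mono F_le)
    moreover have "B q = 1" unfolding B_def using False by (rule if_not_P)
    ultimately show ?thesis by (simp add: power2_eq_square)
  qed
  have G0: "G x \<ge> 0" for x by (simp add: G_def gowers_norm_int_nonneg)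
  \<comment> \<open>There are \<open>L\<close> windows sticking out on each side, hence the term 2 *
    L.\<close>
  have sumB: "(\<Sum>q\<in>{- int L..int N}. B q) = 16 * (\<Sum>n=1..N + 1 - L. G (n - 1)) + 2 * real L"
  proof -
    have "{- int L..int N} = {0..int N - int L} \<union> ({- int L..-1} \<union> {int N - int L + 1..int N})"
      using L by auto
    then have "(\<Sum>q\<in>{- int L..int N}. B q) = (\<Sum>q\<in>{0..int N - int L}. B q)
        + (\<Sum>q\<in>{- int L..-1} \<union> {int N - int L + 1..int N}. B q)"
      by (simp only:) (subst sum.union_disjoint, use L in auto)
    also have "(\<Sum>q\<in>{- int L..-1} \<union> {int N - int L + 1..int N}. B q)
        = (\<Sum>q\<in>{- int L..-1} \<union> {int N - int L + 1..int N}. 1)"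
      by (intro sum.cong refl) (use L in \<open>auto simp: B_def\<close>)
    also have "\<dots> = 2 * real L"
      by (subst sum.union_disjoint) (use L in auto)
    also have "(\<Sum>q\<in>{0..int N - int L}. B q) = (\<Sum>n=1..N + 1 - L. 16 * G (n - 1))"
      by (rule sum.reindex_bij_witness[where i = "\<lambda>n. int n - 1" and j = "\<lambda>q. nat (q + 1)"])
        (use L in \<open>auto simp: B_def nat_diff_distrib nat_add_distrib\<close>)
    finally show ?thesis by (simp add: sum_distrib_left)
  qed
  \<comment> \<open>Each pair (m, k) lies in exactly \<open>L\<close> windows in either
    variable.\<close>
  have "(real L)\<^sup>2 * X = real L * (\<Sum>m\<in>{1..int H}. real L * (\<Sum>k\<in>{1..int N}. F m k))"
    by (simp add: X_def power2_eq_square sum_distrib_left mult.assoc)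
  also have "\<dots> = real L * (\<Sum>m\<in>{1..int H}. \<Sum>q\<in>{- int L..int N}. \<Sum>j=1..L. F m (q + int j))"
    by (subst sum_over_windows) (use F2 in auto)
  also have "\<dots> = (\<Sum>p\<in>{- int L..int H}. \<Sum>h=1..L. \<Sum>q\<in>{- int L..int N}. \<Sum>j=1..L.
       F (p + int h) (q + int j))"
    by (subst sum_over_windows) (use F1 in auto)
  also have "\<dots> = (\<Sum>p\<in>{- int L..int H}. \<Sum>q\<in>{- int L..int N}. \<Sum>h=1..L. \<Sum>j=1..L.
       F (p + int h) (q + int j))"
    by (intro sum.cong refl sum.swap)
  finally have "\<bar>(real L)\<^sup>2 * X\<bar> \<le> (\<Sum>p\<in>{- int L..int H}. \<Sum>q\<in>{- int L..int N}. (real L)\<^sup>2 * B q)"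
    by (simp only:) (intro order_trans[OF sum_abs] sum_mono window)
  also have "\<dots> = (real L)\<^sup>2 * (real (H + L + 1) * (\<Sum>q\<in>{- int L..int N}. B q))"
    by (simp only: sum_distrib_left[symmetric] sum_constant card_atLeastAtMost_int)
      (simp add: nat_add_distrib algebra_simps)
  finally have "(real L)\<^sup>2 * \<bar>X\<bar> \<le> (real L)\<^sup>2 * (real (H + L + 1) * (\<Sum>q\<in>{- int L..int N}. B q))"
    by (simp add: abs_mult)
  then have "\<bar>X\<bar> \<le> real (H + L + 1) * (\<Sum>q\<in>{- int L..int N}. B q)"
    using L(1) by (subst (asm) mult_le_cancel_left_pos) auto
  \<comment> \<open>There are H + L + 1 starts \<open>p\<close>, and both \<open>L\<close> and 1 are
    at most \<open>H\<close>.\<close>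
  also have "\<dots> \<le> 3 * real H * (\<Sum>q\<in>{- int L..int N}. B q)"
    by (intro mult_right_mono sum_nonneg) (use L G0 in \<open>auto simp: B_def\<close>)
  finally show ?thesis unfolding sumB unfolding X_def F_def G_def .
qed

text \<open>One factor of each square is frozen as a bounded weight \<open>a\<close>; the other is
  expanded. This yields the form in \<open>global_bilinear_sum_le\<close>, whose bound involves
  neither \<open>g\<close> nor \<open>a\<close>, and its factor \<open>H\<close> cancels the
  normalisation.\<close>

lemma sum_convolution_square_le:
  fixes u g :: "nat \<Rightarrow> real" and L H N :: nat
  assumes L: "1 \<le> L" "L \<le> H" "H \<le> N"
    and u: "\<And>n. n \<ge> 1 \<Longrightarrow> \<bar>u n\<bar> \<le> 1" and g: "\<And>n. n \<ge> 1 \<Longrightarrow> \<bar>g n\<bar> \<le> 1"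
  shows "(\<Sum>n=1..N. (1 / real H * (\<Sum>m=1..H. zero_ext u (int n - int m) * g m))\<^sup>2)
    \<le> 3 * (16 * (\<Sum>n=1..N + 1 - L. gowers_norm_int (n - 1) L (\<lambda>n. of_real (u n))) + 2 * real L)"
    (is "_ \<le> 3 * ?R")
proof -
  define A where "A n = 1 / real H * (\<Sum>m=1..H. zero_ext u (n - int m) * g m)" for n
  define a where "a n = (if n \<in> {1..int N} then A n else 0)" for n
  define g' where "g' m = (if m \<in> {1..int H} then g (nat m) else 0)" for m
  have U: "\<bar>zero_ext u k\<bar> \<le> 1" for k using u by (simp add: zero_ext_def)
  have "\<bar>\<Sum>m=1..H. zero_ext u (n - int m) * g m\<bar> \<le> (\<Sum>m=1..H. 1)" for n
    by (intro order_trans[OF sum_abs] sum_mono) (auto simp: abs_mult intro!: mult_le_one U g)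
  then have "\<bar>A n\<bar> \<le> 1" for n
    using L by (simp add: A_def abs_mult divide_le_eq)
  then have a: "\<bar>a n\<bar> \<le> 1" for n by (simp add: a_def)
  \<comment> \<open>Substituting k = n - m loses nothing: indices with n - m < 1 are killed by
    \<open>zero_ext\<close>, those with k + m > N by \<open>a\<close>.\<close>
  have shift: "(\<Sum>n=1..N. a (int n) * zero_ext u (int n - int m))
      = (\<Sum>k\<in>{1..int N}. a (k + int m) * zero_ext u k)" for m
    by (rule sum.reindex_bij_witness_not_neutral[where
        S' = "{n \<in> {1..N}. int n - int m \<notin> {1..int N}}" and T' = "{1..int N} - {..int N - int m}"
        and i = "\<lambda>k. nat (k + int m)" and j = "\<lambda>n. int n - int m"])
      (auto simp: a_def zero_ext_def)
  have "real H * (\<Sum>n=1..N. (A (int n))\<^sup>2) = (\<Sum>n=1..N. a (int n) * (real H * A (int n)))"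
    by (simp add: sum_distrib_left a_def power2_eq_square mult_ac)
  also have "\<dots> = (\<Sum>n=1..N. \<Sum>m=1..H. g m * (a (int n) * zero_ext u (int n - int m)))"
    using L by (intro sum.cong refl) (simp add: A_def sum_distrib_left mult_ac)
  also have "\<dots> = (\<Sum>m=1..H. \<Sum>n=1..N. g m * (a (int n) * zero_ext u (int n - int m)))"
    by (rule sum.swap)
  also have "\<dots> = (\<Sum>m=1..H. \<Sum>k\<in>{1..int N}. g m * (a (k + int m) * zero_ext u k))"
    by (simp only: sum_distrib_left[symmetric] shift)
  also have "\<dots> = (\<Sum>m\<in>{1..int H}. \<Sum>k\<in>{1..int N}. g' m * zero_ext u k * a (k + m))"
    by (rule sum.reindex_bij_witness[where i = nat and j = int]) (auto simp: g'_def mult_ac)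
  also have "\<dots> \<le> 3 * real H * ?R"
    by (rule order_trans[OF abs_ge_self global_bilinear_sum_le])
      (use L u a g in \<open>auto simp: g'_def a_def\<close>)
  finally have "real H * (\<Sum>n=1..N. (A (int n))\<^sup>2) \<le> real H * (3 * ?R)" by (simp add: mult_ac)
  then show ?thesis using L unfolding A_def
    by (subst (asm) mult_le_cancel_left_pos) auto
qed

section \<open>Blocks of the scale sequence\<close>

text \<open>Eventual monotonicity compares late values only; divergence makes \<open>N s\<close>
  exceed the finitely many early ones as well.\<close>

lemma eventually_running_max:
  fixes N :: "nat \<Rightarrow> nat"
  assumes "filterlim N at_top sequentially" "eventually (\<lambda>s. N s \<le> N (s + 1)) sequentially"
  obtains T where "\<And>s i. T \<le> s \<Longrightarrow> i \<le> s \<Longrightarrow> N i \<le> N s"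
proof -
  obtain T0 where T0: "N s \<le> N (s + 1)" if "s \<ge> T0" for s
    using assms(2) by (auto simp: eventually_sequentially)
  have mono: "N i \<le> N s" if "T0 \<le> i" "i \<le> s" for i s
    using that(2) by (induction rule: dec_induct) (use T0 that(1) in \<open>auto intro: order_trans\<close>)
  obtain T1 where T1: "Max (N ` {..T0}) \<le> N s" if "s \<ge> T1" for s
    using assms(1) unfolding filterlim_at_top eventually_sequentially by blast
  show ?thesis
  proof (rule that[of T1])
    fix s i assume "T1 \<le> s" "i \<le> s"
    show "N i \<le> N s"
    proof (cases "i \<le> T0")
      case True
      then have "N i \<le> Max (N ` {..T0})" by (intro Max_ge) auto
      also have "\<dots> \<le> N s" using T1 \<open>T1 \<le> s\<close> .
      finally show ?thesis .
    next
      case False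
      then show ?thesis using mono \<open>i \<le> s\<close> by simp
    qed
  qed
qed

text \<open>The indices that the indicator in \<open>scale_conv\<close> retains at
  \<open>n\<close>.\<close>

definition scales_at :: "(nat \<Rightarrow> nat) \<Rightarrow> nat \<Rightarrow> nat set" where
  "scales_at N n = {t \<in> {1..}. n \<in> {N (t - 1)<..N t}}"

lemma scale_conv_eq_sum:
  assumes "finite (scales_at N n)"
  shows "scale_conv N H f g n =
    (\<Sum>t\<in>scales_at N n. 1 / real (H t) * (\<Sum>m=1..H t. zero_ext f (int n - int m) * g m))"
proof -
  have "scale_conv N H f g n = (\<Sum>\<^sub>\<infinity>t\<in>scales_at N n.
      1 / real (H t) * (\<Sum>m=1..H t. zero_ext f (int n - int m) * g m))"
    unfolding scale_conv_def
    by (rule infsum_cong_neutral) (auto simp: scales_at_def indicator_def)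
  then show ?thesis using assms by simp
qed

text \<open>
  The sequence \<open>N\<close> need not be monotone at the beginning, so the blocks may overlap there.
\<close>

lemma scales_at_subset:
  assumes "\<And>s i. T \<le> s \<Longrightarrow> i \<le> s \<Longrightarrow> N i \<le> N s" "T < s" "s \<in> scales_at N n"
  shows "scales_at N n \<subseteq> {..T} \<union> {s}"
proof -
  have "t = s" if t: "t \<in> scales_at N n" "T < t" for t
  proof (rule ccontr)
    assume "t \<noteq> s"
    then consider "t \<le> s - 1" | "s \<le> t - 1" by linarith
    then show False
    proof cases
      case 1
      then have "N t \<le> N (s - 1)" using assms(1) t(2) by simp
      then show False using t(1) assms(3) by (simp add: scales_at_def)
    next
      case 2
      then have "N s \<le> N (t - 1)" using assms(1,2) by simp
      then show False using t(1) assms(3) by (simp add: scales_at_def)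
    qed
  qed
  then show ?thesis by force
qed

text \<open>At most T + 1 early indices and one late index occur. Uniformity in \<open>n\<close>
  makes the trivial bound on earlier blocks usable.\<close>

lemma scales_at_finite_card:
  assumes "\<And>s i. T \<le> s \<Longrightarrow> i \<le> s \<Longrightarrow> N i \<le> N s"
  shows "finite (scales_at N n) \<and> card (scales_at N n) \<le> T + 2"
proof -
  obtain s where sub: "scales_at N n \<subseteq> {..T} \<union> {s}"
  proof (cases "\<exists>s>T. s \<in> scales_at N n")
    case True
    then show ?thesis using scales_at_subset[of T N, OF assms] that by blast
  next
    case False
    \<comment> \<open>Without a late index, 0 is a dummy already contained in
      \<open>{..T}\<close>.\<close>
    then have "scales_at N n \<subseteq> {..T} \<union> {0}" by (meson atMost_iff not_le subsetI UnI1)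
    then show ?thesis by (rule that)
  qed
  have "card (scales_at N n) \<le> card ({..T} \<union> {s})" by (rule card_mono[OF _ sub]) simp
  also have "\<dots> \<le> T + 2" by (rule order_trans[OF card_Un_le]) simp
  finally show ?thesis using finite_subset[OF sub] by simp
qed

lemma scales_at_eq_singleton:
  assumes "\<And>s i. T \<le> s \<Longrightarrow> i \<le> s \<Longrightarrow> N i \<le> N s" "T < s" "n \<in> {N (s - 1)<..N s}"
  shows "scales_at N n = {s}"
proof -
  have s: "s \<in> scales_at N n" using assms(2,3) by (simp add: scales_at_def)
  have "t \<notin> scales_at N n" if "t \<le> T" for t
  proof -
    have "N t \<le> N (s - 1)" using that assms(1)[of "s - 1" t] assms(2) by simp
    then show ?thesis using assms(3) by (simp add: scales_at_def)
  qed
  then show ?thesis using scales_at_subset[of T N, OF assms(1,2) s] s by auto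
qed

section \<open>The estimate at one index and the limit\<close>

lemma abs_average_le_1:
  fixes F :: "nat \<Rightarrow> real"
  assumes "\<And>m. m \<in> {1..K} \<Longrightarrow> \<bar>F m\<bar> \<le> 1"
  shows "\<bar>1 / real K * (\<Sum>m=1..K. F m)\<bar> \<le> 1"
proof -
  have "\<bar>\<Sum>m=1..K. F m\<bar> \<le> (\<Sum>m=1..K. 1)"
    by (intro order_trans[OF sum_abs] sum_mono assms)
  \<comment> \<open>For \<open>K = 0\<close> division by zero makes the average 0.\<close>
  then show ?thesis by (cases "K = 0") (simp_all add: abs_mult divide_le_eq)
qed

lemma scale_conv_diff_eq_sum:
  assumes "finite (scales_at N n)" "\<And>n. n \<ge> 1 \<Longrightarrow> f n = f' n + u n"
  shows "scale_conv N H f g n - scale_conv N H f' g n =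
    (\<Sum>t\<in>scales_at N n. 1 / real (H t) * (\<Sum>m=1..H t. zero_ext u (int n - int m) * g m))"
proof -
  have "zero_ext f k = zero_ext f' k + zero_ext u k" for k
    using assms(2) by (simp add: zero_ext_def)
  then show ?thesis
    unfolding scale_conv_eq_sum[OF assms(1)] sum_subtractf[symmetric]
    by (simp add: algebra_simps sum.distrib flip: sum_subtractf)
qed

text \<open>Up to \<open>N (s - 1)\<close> the difference is bounded by T + 2; on the last block it
  is a single average at scale \<open>H s\<close>, controlled by the local norms of
  \<open>u\<close>.\<close>

lemma l2_norm_upto_scale_conv_diff_le:
  fixes f f' u g :: "nat \<Rightarrow> real" and N H :: "nat \<Rightarrow> nat"
  assumes N: "\<And>s i. T \<le> s \<Longrightarrow> i \<le> s \<Longrightarrow> N i \<le> N s" and s: "T < s"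
    and f: "\<And>n. n \<ge> 1 \<Longrightarrow> f n = f' n + u n"
    and u: "\<And>n. n \<ge> 1 \<Longrightarrow> \<bar>u n\<bar> \<le> 1" and g: "\<And>n. n \<ge> 1 \<Longrightarrow> \<bar>g n\<bar> \<le> 1"
    and L: "1 \<le> L" "L \<le> H s" "H s \<le> N s"
  shows "l2_norm_upto (N s) (\<lambda>n. scale_conv N H f g n - scale_conv N H f' g n)
    \<le> sqrt ((real T + 2)\<^sup>2 * (real (N (s - 1)) / real (N s))
        + 48 * (1 / real (N s + 1 - L) *
            (\<Sum>n=1..N s + 1 - L. gowers_norm_int (n - 1) L (\<lambda>n. of_real (u n))))
        + 6 * (real L / real (N s)))"
proof -
  define D where "D n = scale_conv N H f g n - scale_conv N H f' g n" for n
  define A where "A t n = 1 / real (H t) * (\<Sum>m=1..H t. zero_ext u (int n - int m) * g m)" for t n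
  define \<Gamma> where "\<Gamma> = (\<Sum>n=1..N s + 1 - L. gowers_norm_int (n - 1) L (\<lambda>n. of_real (u n)))"
  have \<Gamma>: "\<Gamma> \<ge> 0" by (simp add: \<Gamma>_def sum_nonneg gowers_norm_int_nonneg)
  have D_eq: "D n = (\<Sum>t\<in>scales_at N n. A t n)" for n
    unfolding D_def A_def
    by (rule scale_conv_diff_eq_sum) (use scales_at_finite_card[of T N, OF N] f in auto)
  have A_le: "\<bar>A t n\<bar> \<le> 1" for t n
    unfolding A_def
    by (rule abs_average_le_1) (auto simp: abs_mult zero_ext_def intro!: mult_le_one u g)
  have D_le: "\<bar>D n\<bar> \<le> real T + 2" for n
  proof -
    have "\<bar>D n\<bar> \<le> (\<Sum>t\<in>scales_at N n. 1)"
      unfolding D_eq by (intro order_trans[OF sum_abs] sum_mono A_le)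
    also have "\<dots> \<le> real (T + 2)"
      using scales_at_finite_card[of T N n, OF N] by (simp only: sum_constant) simp
    finally show ?thesis by simp
  qed
  have D_block: "D n = A s n" if "n \<in> {N (s - 1)<..N s}" for n
    unfolding D_eq using scales_at_eq_singleton[of T N, OF N s that] by simp
  have le: "N (s - 1) \<le> N s" using N s by simp
  have "{1..N s} = {1..N (s - 1)} \<union> {N (s - 1)<..N s}" using le by auto
  then have "(\<Sum>n=1..N s. (D n)\<^sup>2) = (\<Sum>n=1..N (s - 1). (D n)\<^sup>2) + (\<Sum>n\<in>{N (s - 1)<..N s}. (D n)\<^sup>2)"
    by (simp only:) (subst sum.union_disjoint, auto)
  also have "(\<Sum>n=1..N (s - 1). (D n)\<^sup>2) \<le> (\<Sum>n=1..N (s - 1). (real T + 2)\<^sup>2)"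
    using D_le by (intro sum_mono) (metis abs_ge_zero power2_abs power_mono)
  also have "(\<Sum>n\<in>{N (s - 1)<..N s}. (D n)\<^sup>2) = (\<Sum>n\<in>{N (s - 1)<..N s}. (A s n)\<^sup>2)"
    by (intro sum.cong refl) (simp add: D_block)
  \<comment> \<open>Squares are nonnegative, so the block may be enlarged to the full interval of
    the convolution estimate.\<close>
  also have "\<dots> \<le> (\<Sum>n=1..N s. (A s n)\<^sup>2)"
    by (intro sum_mono2) auto
  also have "\<dots> \<le> 3 * (16 * \<Gamma> + 2 * real L)"
    unfolding A_def \<Gamma>_def by (rule sum_convolution_square_le) (use L u g in auto)
  finally have "(\<Sum>n=1..N s. (D n)\<^sup>2) \<le> (real T + 2)\<^sup>2 * real (N (s - 1)) + 48 * \<Gamma> + 6 * real L"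
    by (simp add: mult_ac)
  then have "1 / real (N s) * (\<Sum>n=1..N s. (D n)\<^sup>2)
     \<le> 1 / real (N s) * ((real T + 2)\<^sup>2 * real (N (s - 1)) + 48 * \<Gamma> + 6 * real L)"
    by (intro mult_left_mono) auto
  also have "\<dots> = (real T + 2)\<^sup>2 * (real (N (s - 1)) / real (N s)) + 48 * (1 / real (N s) * \<Gamma>)
      + 6 * (real L / real (N s))"
    by (simp add: algebra_simps add_divide_distrib)
  \<comment> \<open>This matches the normalisation in \<open>has_gowers_norm\<close>; it only
    enlarges the bound because \<open>L\<close> is at least 1.\<close>
  also have "1 / real (N s) * \<Gamma> \<le> 1 / real (N s + 1 - L) * \<Gamma>"
    by (intro mult_right_mono[OF _ \<Gamma>] divide_left_mono) (use L in auto)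
  finally show ?thesis
    unfolding l2_norm_upto_def \<Gamma>_def D_def by simp
qed

theorem theorem9p3:
  fixes f f_str f_unf :: "nat \<Rightarrow> real" and N H :: "nat \<Rightarrow> nat"
  assumes "\<forall>n\<ge>1. f n \<in> {0..1}"
    and "N 0 = 0" and "\<forall>s\<ge>1. N s \<ge> 1" and "\<forall>s\<ge>1. H s \<ge> 1"
    and "filterlim H at_top sequentially" and "seq_prec H N"
    and "(\<lambda>s. real (N s) / real (N (s + 1))) \<longlonglongrightarrow> 0"
    and "U2_good_scale N H f"
    and "U2_good_decomposition N H f f_str f_unf"
  shows "(\<lambda>s. SUP g \<in> {g :: nat \<Rightarrow> real. \<forall>n\<ge>1. g n \<in> {0..1}}.
            l2_norm_upto (N s) (\<lambda>n. scale_conv N H f g n - scale_conv N H f_str g n))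
         \<longlonglongrightarrow> 0"
proof -
  let ?g = "{g :: nat \<Rightarrow> real. \<forall>n\<ge>1. g n \<in> {0..1}}"
  let ?u = "\<lambda>n. complex_of_real (f_unf n)"
  have f: "f n = f_str n + f_unf n" and f_str: "f_str n \<in> {0..1}" if "n \<ge> 1" for n
    using assms(9) that unfolding U2_good_decomposition_def by blast+
  have u: "\<bar>f_unf n\<bar> \<le> 1" if "n \<ge> 1" for n
    using f[OF that] f_str[OF that] assms(1) that by auto
  \<comment> \<open>The window length is the finer scale of the uniformity condition on
    \<open>f_unf\<close>.\<close>
  obtain L where L: "\<forall>s\<ge>1. L s \<ge> 1" "seq_prec L H" "has_gowers_norm N L ?u 0"
    using assms(9) unfolding U2_good_decomposition_def by blast
  have ev_le: "\<forall>\<^sub>F s in sequentially. X s \<le> Y s"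
    if "seq_prec X Y" "\<forall>s\<ge>1. Y s \<ge> 1" for X Y :: "nat \<Rightarrow> nat"
  proof -
    have "\<forall>\<^sub>F s in sequentially. real (X s) / real (Y s) < 1"
      using that(1) unfolding seq_prec_def by (rule order_tendstoD) simp
    then show ?thesis using eventually_ge_at_top[of 1]
    proof eventually_elim
      case (elim s)
      then have "real (Y s) > 0" using that(2) by (simp add: Suc_le_eq)
      then show ?case using elim(1) by (simp add: divide_less_eq)
    qed
  qed
  have HN: "\<forall>\<^sub>F s in sequentially. H s \<le> N s" using ev_le[OF assms(6,3)] .
  have LH: "\<forall>\<^sub>F s in sequentially. L s \<le> H s" using ev_le[OF L(2) assms(4)] .
  have "filterlim N at_top sequentially"
    by (rule filterlim_at_top_mono[OF assms(5) HN])
  moreover have "\<forall>\<^sub>F s in sequentially. N s \<le> N (s + 1)"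
    by (rule ev_le) (use assms(3,7) in \<open>auto simp: seq_prec_def\<close>)
  ultimately obtain T where T: "\<And>s i. T \<le> s \<Longrightarrow> i \<le> s \<Longrightarrow> N i \<le> N s"
    using eventually_running_max by blast
  define bound where "bound s = sqrt ((real T + 2)\<^sup>2 * (real (N (s - 1)) / real (N s))
        + 48 * (1 / real (N s + 1 - L s) * (\<Sum>n=1..N s + 1 - L s. gowers_norm_int (n - 1) (L s) ?u))
        + 6 * (real (L s) / real (N s)))" for s
  have "(\<lambda>s. real (N (s - 1)) / real (N s)) \<longlonglongrightarrow> 0"
    using assms(7) by (subst filterlim_sequentially_Suc[symmetric]) simp
  moreover have "(\<lambda>s. real (L s) / real (N s)) \<longlonglongrightarrow> 0"
  proof (rule Lim_transform_eventually)
    show "(\<lambda>s. real (L s) / real (H s) * (real (H s) / real (N s))) \<longlonglongrightarrow> 0"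
      using tendsto_mult[of _ 0 _ _ 0] L(2) assms(6) unfolding seq_prec_def by fastforce
    show "\<forall>\<^sub>F s in sequentially. real (L s) / real (H s) * (real (H s) / real (N s))
        = real (L s) / real (N s)"
      using eventually_ge_at_top[of 1] by eventually_elim (use assms(4) in \<open>auto simp: Suc_le_eq\<close>)
  qed
  ultimately have "bound \<longlonglongrightarrow> sqrt ((real T + 2)\<^sup>2 * 0 + 48 * 0 + 6 * 0)"
    unfolding bound_def using L(3) unfolding has_gowers_norm_def by (intro tendsto_intros)
  then have bound: "bound \<longlonglongrightarrow> 0" by simp
  \<comment> \<open>The threshold in \<open>s\<close> and \<open>bound\<close> are free of
    \<open>g\<close>, which lets the estimate pass to the supremum.\<close>
  have "\<forall>\<^sub>F s in sequentially. \<forall>g\<in>?g.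
      l2_norm_upto (N s) (\<lambda>n. scale_conv N H f g n - scale_conv N H f_str g n) \<le> bound s"
    using HN LH eventually_gt_at_top[of T] eventually_ge_at_top[of 1]
  proof eventually_elim
    case (elim s)
    show ?case unfolding bound_def
      by (intro ballI l2_norm_upto_scale_conv_diff_le T f u) (use elim L(1) in auto)
  qed
  then have ev: "\<forall>\<^sub>F s in sequentially.
     0 \<le> (SUP g\<in>?g. l2_norm_upto (N s) (\<lambda>n. scale_conv N H f g n - scale_conv N H f_str g n)) \<and>
     (SUP g\<in>?g. l2_norm_upto (N s) (\<lambda>n. scale_conv N H f g n - scale_conv N H f_str g n)) \<le> bound s"
  proof eventually_elim
    case (elim s)
    define l where "l g = l2_norm_upto (N s) (\<lambda>n. scale_conv N H f g n - scale_conv N H f_str g n)" for g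
    have l: "l g \<le> bound s" if "g \<in> ?g" for g
      unfolding l_def using elim that by (rule bspec)
    \<comment> \<open>The zero function shows that the index set is nonempty, as a real supremum
      requires, and supplies the lower bound 0.\<close>
    have zero: "(\<lambda>_. 0) \<in> ?g" by simp
    have "bdd_above (l ` ?g)" using l by (rule bdd_aboveI2)
    then have upper: "l (\<lambda>_. 0) \<le> (SUP g\<in>?g. l g)" by (rule cSUP_upper[OF zero])
    have "0 \<le> l (\<lambda>_. 0)" by (simp add: l_def l2_norm_upto_def sum_nonneg)
    from this upper have "0 \<le> (SUP g\<in>?g. l g)" by (rule order_trans)
    moreover have "?g \<noteq> {}" using zero by (metis empty_iff)
    then have "(SUP g\<in>?g. l g) \<le> bound s" using l by (rule cSUP_least)
    ultimately show ?case unfolding l_def by (rule conjI)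
  qed
  show ?thesis
    by (rule tendsto_sandwich[OF _ _ tendsto_const bound]; rule eventually_mono[OF ev]; elim conjE)
qed

end
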